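(* There exist orthogonality factors $A_1,\dots,A_6\in\mathbb{Z}^{3\times3}$ whose $9^6$ products of entry squares are pairwise distinct and a map $L\in GL_6(\mathbb{F}_3)$ such that $M_L(A_1,\dots,A_6)$ is a proper Euler magic matrix of order $729=3^6$ with constant $$\gamma_{729}=1\,383\,621\,370\,577\,137\,212\,748\,452\,225;$$ and there exist orthogonality factors $B_1,\dots,B_7\in\mathbb{Z}^{3\times3}$ whose $9^7$ products of entry squares are pairwise distinct and a map $L'\in GL_7(\mathbb{F}_3)$ such that $M_{L'}(B_1,\dots,B_7)$ is a proper Euler magic matrix of order $2187=3^7$ with constant $$\gamma_{2187}=1\,374\,777\,097\,726\,234\,503\,832\,371\,133\,749\,225.$$
   Context: An orthogonality factor with constant $\gamma$ is a matrix $A\in\mathbb{Z}^{n\times n}$ with $AA^{\mathsf T}=\gamma I$ and $\gamma\ne0$. For $A_1,\dots,A_k\in\mathbb{Z}^{3\times 3}$, the $9^k$ products of entry squares are the numbers $\prod_{i=1}^k (A_i)_{x_i,y_i}^2$ indexed by $(x_1,y_1,\dots,x_k,y_k)\in(\mathbb{F}_3\times\mathbb{F}_3)^k$; they are pairwise distinct if different index tuples give different products. A matrix $M\in\mathbb{Z}^{n\times n}$ (indices $0,\dots,n-1$) is an Euler magic matrix of order $n$ with constant $\gamma\in\mathbb{Z}$, $\gamma\ne0$, if $MM^{\mathsf T}=\gamma I$, $\sum_{i=0}^{n-1}M_{i,i}^2=\gamma$ and $\sum_{i=0}^{n-1}M_{i,n-1-i}^2=\gamma$. It is proper if the $n^2$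 entry squares $M_{i,j}^2$ are pairwise distinct. The set $\{0,1,\dots,3^k-1\}$ is identified with $\mathbb{F}_3^k$ by base-three digits, most significant first: $v=(v_1,\dots,v_k)$ corresponds to $\sum_{i=1}^k v_i3^{k-i}$ (with $v_i\in\{0,1,2\}$). Rows and columns of $3\times 3$ matrices are indexed by $\mathbb{F}_3=\{0,1,2\}$. For $L\in GL_k(\mathbb{F}_3)$ and $A_1,\dots,A_k\in\mathbb{Z}^{3\times3}$, the $L$-reindexed tensor product $M_L(A_1,\dots,A_k)\in\mathbb{Z}^{3^k\times3^k}$ has entries $M_L(A_1,\dots,A_k)_{v,w}=\prod_{i=1}^k(A_i)_{(Lv)_i,\,w_i}$ for $v,w\in\mathbb{F}_3^k$. *)

theory Defs
  imports "Jordan_Normal_Form.Matrix" "HOL-Library.Numeral_Type" "HOL-Library.FuncSet"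
begin

text \<open>
  The field \<open>\<F>\<^sub>3\<close> is the numeral type \<open>3\<close>, whose ring operations are those of the
  integers modulo 3.
\<close>

lemma F3_exhaust: "(x :: 3) = 0 \<or> x = 1 \<or> x = 2"
proof (cases x)
  case (of_int z)
  then have "z = 0 \<or> z = 1 \<or> z = 2"
    by auto
  then show ?thesis
    using of_int by auto
qed

lemma F3_field: "(x :: 3) \<noteq> 0 \<Longrightarrow> \<exists>y. x * y = 1"
proof -
  assume "x \<noteq> 0"
  then have "x = 1 \<or> x = 2"
    using F3_exhaust[of x] by blast
  then have "x * x = 1"
    by (elim disjE) simp_all
  then show ?thesis ..
qed

definition F3_to_nat :: "3 \<Rightarrow> nat" where
  "F3_to_nat x = (if x = 0 then 0 else if x = 1 then 1 else 2)"

lemma of_nat_F3_to_nat: "of_nat (F3_to_nat x) = x"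
  using F3_exhaust[of x] by (auto simp: F3_to_nat_def)

lemma F3_to_nat_of_nat: "F3_to_nat (of_nat n) = n mod 3"
proof -
  have "(of_nat 3 :: 3) = 0"
    by simp
  then have "(of_nat (n mod 3 + 3 * (n div 3)) :: 3) = of_nat (n mod 3)"
    by (simp only: of_nat_add of_nat_mult mult_zero_left add_0_right)
  then have eq: "(of_nat n :: 3) = of_nat (n mod 3)"
    by simp
  consider "n mod 3 = 0" | "n mod 3 = 1" | "n mod 3 = 2" by linarith
  then show ?thesis by cases (auto simp: eq F3_to_nat_def)
qed

text \<open>
  Base-three digits, most significant first.  Coordinates are numbered from \<open>0\<close>, so the
  coordinate \<open>i\<close> carries the weight \<open>3 ^ (k - 1 - i)\<close>; reduction modulo 3 is performed by
  the conversion into the type \<open>3\<close>.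
\<close>

definition digits3 :: "nat \<Rightarrow> nat \<Rightarrow> 3 vec" where
  "digits3 k n = vec k (\<lambda>i. of_nat (n div 3 ^ (k - 1 - i)))"

lemma sum_digits3:
  assumes "n < 3 ^ k"
  shows "(\<Sum>i<k. F3_to_nat (digits3 k n $ i) * 3 ^ (k - 1 - i)) = n"
proof -
  have "(\<Sum>i<k. (m div 3 ^ (k - 1 - i)) mod 3 * 3 ^ (k - 1 - i)) = m" if "m < 3 ^ k" for m k :: nat
    using that
  proof (induction k arbitrary: m)
    case (Suc k)
    have "(\<Sum>i<k. (m div 3 ^ (k - i)) mod 3 * 3 ^ (k - i)) =
          3 * (\<Sum>i<k. ((m div 3) div 3 ^ (k - 1 - i)) mod 3 * 3 ^ (k - 1 - i))"
      unfolding sum_distrib_left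
    proof (rule sum.cong)
      fix i assume "i \<in> {..<k}"
      then have "k - i = Suc (k - 1 - i)" by auto
      then show "(m div 3 ^ (k - i)) mod 3 * 3 ^ (k - i) =
          3 * (((m div 3) div 3 ^ (k - 1 - i)) mod 3 * 3 ^ (k - 1 - i))"
        by (simp add: div_mult2_eq)
    qed simp
    also have "\<dots> = 3 * (m div 3)"
      using Suc.prems by (subst Suc.IH) auto
    finally show ?case by simp
  qed simp
  then show ?thesis
    using assms by (simp add: digits3_def F3_to_nat_of_nat)
qed

definition orthogonality_factor :: "nat \<Rightarrow> int mat \<Rightarrow> int \<Rightarrow> bool" where
  "orthogonality_factor n A \<gamma> \<longleftrightarrow>
     A \<in> carrier_mat n n \<and> \<gamma> \<noteq> 0 \<and> A * transpose_mat A = \<gamma> \<cdot>\<^sub>m 1\<^sub>m n"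

definition distinct_square_products :: "nat \<Rightarrow> (nat \<Rightarrow> int mat) \<Rightarrow> bool" where
  "distinct_square_products k A \<longleftrightarrow>
     inj_on (\<lambda>z. \<Prod>i<k. (A i $$ z i)\<^sup>2) ({..<k} \<rightarrow>\<^sub>E {..<3} \<times> {..<3})"

definition euler_magic :: "nat \<Rightarrow> int \<Rightarrow> int mat \<Rightarrow> bool" where
  "euler_magic n \<gamma> M \<longleftrightarrow>
     M \<in> carrier_mat n n \<and> \<gamma> \<noteq> 0 \<and> M * transpose_mat M = \<gamma> \<cdot>\<^sub>m 1\<^sub>m n \<and>
     (\<Sum>i<n. (M $$ (i, i))\<^sup>2) = \<gamma> \<and> (\<Sum>i<n. (M $$ (i, n - 1 - i))\<^sup>2) = \<gamma>"

definition proper_euler_magic :: "nat \<Rightarrow> int \<Rightarrow> int mat \<Rightarrow> bool" where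
  "proper_euler_magic n \<gamma> M \<longleftrightarrow>
     euler_magic n \<gamma> M \<and> inj_on (\<lambda>ij. (M $$ ij)\<^sup>2) ({..<n} \<times> {..<n})"

definition reindexed_tensor :: "nat \<Rightarrow> 3 mat \<Rightarrow> (nat \<Rightarrow> int mat) \<Rightarrow> int mat" where
  "reindexed_tensor k L A = mat (3 ^ k) (3 ^ k) (\<lambda>(v, w).
     \<Prod>i<k. A i $$ (F3_to_nat ((L *\<^sub>v digits3 k v) $ i), F3_to_nat (digits3 k w $ i)))"

end

theory Submission
  imports Defs "HOL-Computational_Algebra.Primes"
begin

text \<open>
  Orthogonality and distinctness of the reindexed tensor product hold for every invertible \<open>L\<close>,
  because the sums over rows factor digit by digit.  The squared entries of an orthogonality factor
  form a semimagic square, and if \<open>L\<close> is block diagonal with suitable blocks of size 2 and 3, both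
  diagonal sums factor over the blocks into sums that equal the product of the magic constants for
  any semimagic squares whatsoever.  The factors are integer multiples of rotation matrices given by
  quaternions, with norms chosen so that their product is the square root of the prescribed constant.
  They are chosen such that many entries have a prime factor occurring in no other factor; comparing
  \<open>p\<close>-adic valuations of two equal products of entries then successively forces
  the index tuples to agree.
\<close>

subsection \<open>Base-three digits\<close>

lemma UNIV_F3: "(UNIV :: 3 set) = {0, 1, 2}"
  using F3_exhaust by auto

lemma sum_F3: "(\<Sum>x\<in>(UNIV :: 3 set). f x) = f 0 + f 1 + f 2"
proof -
  have "(0 :: 3) \<noteq> 1" "(0 :: 3) \<noteq> 2" "(1 :: 3) \<noteq> 2"
    by simp_all
  then have "sum f {0, 1, 2} = f 0 + (f 1 + f 2)"
    by simp
  then show ?thesis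
    by (simp only: UNIV_F3 add.assoc)
qed

lemma F3_to_nat_simps [simp]:
  "F3_to_nat 0 = 0" "F3_to_nat 1 = 1" "F3_to_nat 2 = 2"
  by (simp_all add: F3_to_nat_def)

lemma F3_to_nat_less [simp]: "F3_to_nat x < 3"
  by (simp add: F3_to_nat_def)

lemma F3_to_nat_le [simp]: "F3_to_nat x \<le> 2"
  by (simp add: F3_to_nat_def)

lemma F3_to_nat_inject [simp]: "F3_to_nat x = F3_to_nat y \<longleftrightarrow> x = y"
  by (metis of_nat_F3_to_nat)

lemma sum_lessThan_3_F3: "(\<Sum>x<3. f x) = (\<Sum>x\<in>UNIV. f (F3_to_nat x))"
  by (simp add: sum_F3 eval_nat_numeral)

lemma digits3_carrier [simp]: "digits3 k n \<in> carrier_vec k"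
  by (simp add: digits3_def)

lemma dim_digits3 [simp]: "dim_vec (digits3 k n) = k"
  by (simp add: digits3_def)

lemma inj_on_digits3: "inj_on (digits3 k) {..<3 ^ k}"
  by (rule inj_onI) (metis sum_digits3 lessThan_iff)

lemma digits3_0: "digits3 0 n = vNil"
  by (rule eq_vecI) (simp_all add: digits3_def)

lemma of_nat_3_mult_F3: "(of_nat (3 * n) :: 3) = 0"
  by (metis F3_to_nat_of_nat F3_to_nat_simps(1) F3_to_nat_inject mod_mult_self1_is_0)

text \<open>Coordinate 0 is the leading digit. For a lower coordinate the divisor is
  \<open>3 ^ e\<close> with \<open>e < k\<close>, so \<open>F3_to_nat a * 3 ^ k\<close> contributes
  a multiple of 3 to the quotient, which vanishes in the type \<open>3\<close>.\<close>

lemma digits3_Suc: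
  assumes "n < 3 ^ k"
  shows "digits3 (Suc k) (F3_to_nat a * 3 ^ k + n) = vCons a (digits3 k n)"
proof (rule eq_vecI)
  fix i assume "i < dim_vec (vCons a (digits3 k n))"
  then have i: "i < Suc k" by simp
  show "digits3 (Suc k) (F3_to_nat a * 3 ^ k + n) $ i = vCons a (digits3 k n) $ i"
  proof (cases i)
    case 0
    then show ?thesis
      using assms by (simp add: digits3_def of_nat_F3_to_nat)
  next
    case (Suc j)
    then have j: "j < k" and k: "k = (k - 1 - j) + Suc j"
      using i by auto
    define e where "e = k - 1 - j"
    have "(3::nat) ^ k = 3 ^ e * (3 * 3 ^ j)"
      by (subst k) (simp add: e_def power_add)
    then have "F3_to_nat a * 3 ^ k + n = n + 3 * (F3_to_nat a * 3 ^ j) * 3 ^ e"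
      by (simp add: ac_simps)
    then have "(F3_to_nat a * 3 ^ k + n) div 3 ^ e = 3 * (F3_to_nat a * 3 ^ j) + n div 3 ^ e"
      by (simp only: div_mult_self1 power_not_zero) simp
    moreover have "k - i = e"
      using Suc by (simp add: e_def)
    ultimately show ?thesis
      using i j Suc by (simp add: digits3_def e_def[symmetric] of_nat_3_mult_F3 del: of_nat_mult)
  qed
qed simp

text \<open>Division with remainder by \<open>3 ^ k\<close>. Through this bijection, sums over row
  and column numbers are split by the leading digit.\<close>

lemma bij_betw_leading_digit:
  "bij_betw (\<lambda>(a, n). F3_to_nat a * 3 ^ k + n) (UNIV \<times> {..<3 ^ k}) {..<3 ^ Suc k}"
proof (rule bij_betwI')
  show "(\<lambda>(a, n). F3_to_nat a * 3 ^ k + n) x \<in> {..<3 ^ Suc k}" if mem: "x \<in> UNIV \<times> {..<3 ^ k}" for x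
  proof -
    obtain a n where x: "x = (a, n)" "n < 3 ^ k" using mem by (cases x) auto
    have "F3_to_nat a * 3 ^ k \<le> 2 * 3 ^ k"
      by (intro mult_right_mono) auto
    then have "F3_to_nat a * 3 ^ k + n < 3 ^ Suc k"
      using x(2) unfolding power_Suc by linarith
    then show ?thesis by (simp add: x(1))
  qed
  show "((\<lambda>(a, n). F3_to_nat a * 3 ^ k + n) x = (\<lambda>(a, n). F3_to_nat a * 3 ^ k + n) y) = (x = y)"
    if xy: "x \<in> UNIV \<times> {..<3 ^ k}" "y \<in> UNIV \<times> {..<3 ^ k}" for x y
  proof -
    have inj: "F3_to_nat a = F3_to_nat b \<and> m = n"
      if "m < 3 ^ k" "n < 3 ^ k" "F3_to_nat a * 3 ^ k + m = F3_to_nat b * 3 ^ k + n" for a b m n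
    proof -
      have "(F3_to_nat c * 3 ^ k + l) div 3 ^ k = F3_to_nat c" "(F3_to_nat c * 3 ^ k + l) mod 3 ^ k = l"
        if "l < 3 ^ k" for c l
        using that by simp_all
      then show ?thesis
        using that by metis
    qed
    obtain a m b n where "x = (a, m)" "m < 3 ^ k" "y = (b, n)" "n < 3 ^ k"
      using xy by (cases x; cases y) auto
    then show ?thesis
      using inj[of m n a b] by auto
  qed
  show "\<exists>x\<in>UNIV \<times> {..<3 ^ k}. n = (\<lambda>(a, n). F3_to_nat a * 3 ^ k + n) x" if "n \<in> {..<3 ^ Suc k}" for n
  proof
    have "n div 3 ^ k < 3"
      using that by (simp add: less_mult_imp_div_less)
    then show "n = (\<lambda>(a, n). F3_to_nat a * 3 ^ k + n) (of_nat (n div 3 ^ k) :: 3, n mod 3 ^ k)"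
      using div_mult_mod_eq[of n "3 ^ k"] by (simp only: prod.case F3_to_nat_of_nat mod_less)
  qed simp
qed

lemma sum_digits3_Suc:
  "(\<Sum>n<3 ^ Suc k. g (digits3 (Suc k) n)) = (\<Sum>a\<in>UNIV. \<Sum>n<3 ^ k. g (vCons a (digits3 k n)))"
proof -
  have "(\<Sum>n<3 ^ Suc k. g (digits3 (Suc k) n)) =
      (\<Sum>(a, n)\<in>UNIV \<times> {..<3 ^ k}. g (digits3 (Suc k) (F3_to_nat a * 3 ^ k + n)))"
    unfolding sum.reindex_bij_betw[OF bij_betw_leading_digit, symmetric]
    by (simp only: split_def)
  also have "\<dots> = (\<Sum>(a, n)\<in>UNIV \<times> {..<3 ^ k}. g (vCons a (digits3 k n)))"
    by (intro sum.cong) (auto simp: digits3_Suc)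
  finally show ?thesis
    by (simp only: sum.cartesian_product)
qed

text \<open>The distributive law: the digits of \<open>n\<close> range independently over all
  values. Peeling off the leading digit leaves the shifted family
  \<open>\<lambda>i. h (Suc i)\<close>, hence the induction with \<open>h\<close> arbitrary.\<close>

lemma sum_prod_digits3:
  fixes h :: "nat \<Rightarrow> 3 \<Rightarrow> 'a :: comm_semiring_1"
  shows "(\<Sum>n<3 ^ k. \<Prod>i<k. h i (digits3 k n $ i)) = (\<Prod>i<k. \<Sum>x\<in>UNIV. h i x)"
proof (induction k arbitrary: h)
  case (Suc k)
  have "(\<Sum>n<3 ^ Suc k. \<Prod>i<Suc k. h i (digits3 (Suc k) n $ i)) =
      (\<Sum>a\<in>UNIV. \<Sum>n<3 ^ k. h 0 a * (\<Prod>i<k. h (Suc i) (digits3 k n $ i)))"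
    by (subst sum_digits3_Suc[where g = "\<lambda>v. \<Prod>i<Suc k. h i (v $ i)"])
      (simp add: prod.lessThan_Suc_shift del: prod.lessThan_Suc)
  also have "\<dots> = (\<Prod>i<Suc k. \<Sum>x\<in>UNIV. h i x)"
    unfolding prod.lessThan_Suc_shift sum_distrib_left[symmetric] Suc.IH[where h = "\<lambda>i. h (Suc i)"]
      sum_distrib_right[symmetric] by (rule refl)
  finally show ?case .
qed simp

text \<open>All digits of \<open>3 ^ k - 1\<close> equal 2, so the subtraction never borrows. This
  turns the antidiagonal into the reflection \<open>c \<mapsto> 2 - c\<close> of each column
  digit.\<close>

lemma digits3_complement:
  assumes "n < 3 ^ k"
  shows "digits3 k (3 ^ k - 1 - n) = vec k (\<lambda>i. 2 - digits3 k n $ i)"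
  using assms
proof (induction k arbitrary: n)
  case (Suc k)
  then obtain a m where n: "n = F3_to_nat a * 3 ^ k + m" "m < 3 ^ k"
  proof -
    have "n \<in> (\<lambda>(a, n). F3_to_nat a * 3 ^ k + n) ` (UNIV \<times> {..<3 ^ k})"
      using Suc.prems bij_betw_imp_surj_on[OF bij_betw_leading_digit, of k] by simp
    then show ?thesis
      using that by auto
  qed
  \<comment> \<open>Digits are at most 2, so subtraction from 2 modulo 3 agrees with subtraction in
    the naturals.\<close>
  have "F3_to_nat (2 - a) = 2 - F3_to_nat a"
    using F3_exhaust[of a] by (elim disjE) (simp_all add: F3_to_nat_def)
  moreover have "F3_to_nat a * 3 ^ k \<le> 2 * 3 ^ k"
    by (intro mult_right_mono) auto
  ultimately have "3 ^ Suc k - 1 - n = F3_to_nat (2 - a) * 3 ^ k + (3 ^ k - 1 - m)"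
    using n unfolding power_Suc by (simp only: diff_mult_distrib)
  moreover have "3 ^ k - 1 - m < 3 ^ k"
    using n(2) by linarith
  ultimately have "digits3 (Suc k) (3 ^ Suc k - 1 - n) = vCons (2 - a) (vec k (\<lambda>i. 2 - digits3 k m $ i))"
    by (simp only: digits3_Suc Suc.IH[OF n(2)])
  also have "\<dots> = vec (Suc k) (\<lambda>i. 2 - digits3 (Suc k) n $ i)"
    by (intro eq_vecI) (auto simp: n digits3_Suc less_Suc_eq_0_disj)
  finally show ?case .
qed (rule eq_vecI; simp)

lemma invertible_mat_vec_inject:
  assumes "invertible_mat L" "L \<in> carrier_mat k k" "x \<in> carrier_vec k" "y \<in> carrier_vec k"
    "L *\<^sub>v x = L *\<^sub>v y"
  shows "x = y"
proof -
  obtain B where B: "L * B = 1\<^sub>m k" "B * L = 1\<^sub>m (dim_row B)"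
    using assms(1,2) by (auto simp: invertible_mat_def inverts_mat_def)
  \<comment> \<open>\<open>inverts_mat\<close> leaves the shape of \<open>B\<close> open; comparing
    the numbers of columns in both identities makes it square of order \<open>k\<close>.\<close>
  have "dim_col B = k" "dim_row B = k"
    using arg_cong[OF B(1), of dim_col] arg_cong[OF B(2), of dim_col] assms(2) by auto
  then have BL: "B \<in> carrier_mat k k" "B * L = 1\<^sub>m k"
    using B by auto
  have "B *\<^sub>v (L *\<^sub>v v) = v" if "v \<in> carrier_vec k" for v
    using that by (simp add: assoc_mult_mat_vec[symmetric, OF BL(1) assms(2)] BL(2))
  then show ?thesis
    using assms(3-5) by metis
qed

subsection \<open>Reindexed tensor products\<close>

text \<open>Indices are of type \<open>3\<close>, so that linear forms in the digits can be inserted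
  as row indices.\<close>

definition square_entry :: "int mat \<Rightarrow> 3 \<Rightarrow> 3 \<Rightarrow> int" where
  "square_entry A r c = (A $$ (F3_to_nat r, F3_to_nat c))\<^sup>2"

lemma orthogonality_factor_entry:
  assumes "orthogonality_factor 3 A \<gamma>"
  shows "(\<Sum>x\<in>UNIV. A $$ (F3_to_nat r, F3_to_nat x) * A $$ (F3_to_nat s, F3_to_nat x)) =
    (if r = s then \<gamma> else 0)"
proof -
  have A: "A \<in> carrier_mat 3 3" "A * transpose_mat A = \<gamma> \<cdot>\<^sub>m 1\<^sub>m 3"
    using assms by (auto simp: orthogonality_factor_def)
  have "(A * transpose_mat A) $$ (F3_to_nat r, F3_to_nat s) =
      (\<Sum>x<3. A $$ (F3_to_nat r, x) * A $$ (F3_to_nat s, x))"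
    using A(1) by (simp add: scalar_prod_def atLeast0LessThan)
  then show ?thesis
    by (cases "r = s") (simp_all add: A(2) sum_lessThan_3_F3)
qed

text \<open>Used to multiply the Kronecker deltas that the single digits contribute.\<close>

lemma prod_if_all_eq:
  fixes \<gamma> :: "nat \<Rightarrow> 'a :: comm_semiring_1"
  shows "(\<Prod>i<k. if P i then \<gamma> i else 0) = (if \<forall>i<k. P i then \<Prod>i<k. \<gamma> i else 0)"
proof (cases "\<forall>i<k. P i")
  case False
  then show ?thesis
    by (auto intro!: prod_zero)
qed simp

text \<open>Only the two diagonal sums depend on more than the invertibility of \<open>L\<close>, so
  they stay hypotheses. For the rest, injectivity of \<open>v \<mapsto> L v\<close> suffices:
  distinct row numbers give distinct tuples of row indices in the factors.\<close>

lemma proper_euler_magic_reindexed_tensor: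
  fixes L :: "3 mat"
  assumes orth: "\<And>i. i < k \<Longrightarrow> orthogonality_factor 3 (A i) (\<gamma> i)"
    and dist: "distinct_square_products k A"
    and L: "L \<in> carrier_mat k k" "invertible_mat L"
    and diag: "(\<Sum>n<3 ^ k. \<Prod>i<k. square_entry (A i) ((L *\<^sub>v digits3 k n) $ i) (digits3 k n $ i)) =
      (\<Prod>i<k. \<gamma> i)"
    and anti: "(\<Sum>n<3 ^ k. \<Prod>i<k. square_entry (A i) ((L *\<^sub>v digits3 k n) $ i) (2 - digits3 k n $ i)) =
      (\<Prod>i<k. \<gamma> i)"
  shows "proper_euler_magic (3 ^ k) (\<Prod>i<k. \<gamma> i) (reindexed_tensor k L A)"
proof -
  let ?M = "reindexed_tensor k L A"
  have M: "?M $$ (v, w) = (\<Prod>i<k. A i $$ (F3_to_nat ((L *\<^sub>v digits3 k v) $ i), F3_to_nat (digits3 k w $ i)))"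
    if "v < 3 ^ k" "w < 3 ^ k" for v w
    using that by (simp add: reindexed_tensor_def)
  have sq: "(?M $$ (v, w))\<^sup>2 = (\<Prod>i<k. square_entry (A i) ((L *\<^sub>v digits3 k v) $ i) (digits3 k w $ i))"
    if "v < 3 ^ k" "w < 3 ^ k" for v w
    using that by (simp add: M square_entry_def prod_power_distrib)
  have Linj: "v = v'" if "v < 3 ^ k" "v' < 3 ^ k" "\<forall>i<k. (L *\<^sub>v digits3 k v) $ i = (L *\<^sub>v digits3 k v') $ i" for v v'
  proof -
    have "L *\<^sub>v digits3 k v = L *\<^sub>v digits3 k v'"
      using that(3) L(1) by (intro eq_vecI) auto
    then have "digits3 k v = digits3 k v'"
      by (rule invertible_mat_vec_inject[OF L(2,1) digits3_carrier digits3_carrier])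
    then show ?thesis
      using that(1,2) inj_on_digits3[of k] by (simp add: inj_on_eq_iff)
  qed
  have carrier: "?M \<in> carrier_mat (3 ^ k) (3 ^ k)"
    by (simp add: reindexed_tensor_def)
  have "?M * transpose_mat ?M = (\<Prod>i<k. \<gamma> i) \<cdot>\<^sub>m 1\<^sub>m (3 ^ k)"
  proof (rule eq_matI)
    fix v v' assume "v < dim_row ((\<Prod>i<k. \<gamma> i) \<cdot>\<^sub>m 1\<^sub>m (3 ^ k))" "v' < dim_col ((\<Prod>i<k. \<gamma> i) \<cdot>\<^sub>m 1\<^sub>m (3 ^ k))"
    then have v: "v < 3 ^ k" "v' < 3 ^ k" by auto
    let ?r = "\<lambda>i. (L *\<^sub>v digits3 k v) $ i" and ?r' = "\<lambda>i. (L *\<^sub>v digits3 k v') $ i"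
    have "(?M * transpose_mat ?M) $$ (v, v') = (\<Sum>w<3 ^ k. ?M $$ (v, w) * ?M $$ (v', w))"
      using carrier v by (simp add: scalar_prod_def atLeast0LessThan)
    also have "\<dots> = (\<Sum>w<3 ^ k. \<Prod>i<k.
        A i $$ (F3_to_nat (?r i), F3_to_nat (digits3 k w $ i)) *
        A i $$ (F3_to_nat (?r' i), F3_to_nat (digits3 k w $ i)))"
      using v by (intro sum.cong) (simp_all add: M prod.distrib)
    \<comment> \<open>The sum over \<open>w\<close> becomes a product of inner products of rows of
      the single factors.\<close>
    also have "\<dots> = (\<Prod>i<k. if ?r i = ?r' i then \<gamma> i else 0)"
      by (simp add: sum_prod_digits3[where h = "\<lambda>i x. A i $$ (F3_to_nat (?r i), F3_to_nat x) *
          A i $$ (F3_to_nat (?r' i), F3_to_nat x)"] orthogonality_factor_entry[OF orth])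
    \<comment> \<open>By \<open>Linj\<close>, two distinct rows differ in the row index of some
      factor, whose inner product then vanishes.\<close>
    also have "\<dots> = (if v = v' then \<Prod>i<k. \<gamma> i else 0)"
      unfolding prod_if_all_eq using Linj v by metis
    finally show "(?M * transpose_mat ?M) $$ (v, v') = ((\<Prod>i<k. \<gamma> i) \<cdot>\<^sub>m 1\<^sub>m (3 ^ k)) $$ (v, v')"
      using v by simp
  qed (use carrier in auto)
  moreover have "(\<Prod>i<k. \<gamma> i) \<noteq> 0"
    using orth by (simp add: orthogonality_factor_def)
  moreover have "(\<Sum>n<3 ^ k. (?M $$ (n, n))\<^sup>2) = (\<Prod>i<k. \<gamma> i)"
    unfolding diag[symmetric] by (intro sum.cong) (simp_all add: sq)
  moreover have "(\<Sum>n<3 ^ k. (?M $$ (n, 3 ^ k - 1 - n))\<^sup>2) = (\<Prod>i<k. \<gamma> i)"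
    unfolding anti[symmetric]
  proof (intro sum.cong refl)
    fix n :: nat assume "n \<in> {..<3 ^ k}"
    then have n: "n < 3 ^ k" "3 ^ k - 1 - n < 3 ^ k" by auto
    show "(?M $$ (n, 3 ^ k - 1 - n))\<^sup>2 =
        (\<Prod>i<k. square_entry (A i) ((L *\<^sub>v digits3 k n) $ i) (2 - digits3 k n $ i))"
      unfolding sq[OF n] digits3_complement[OF n(1)] by simp
  qed
  moreover have "inj_on (\<lambda>ij. (?M $$ ij)\<^sup>2) ({..<3 ^ k} \<times> {..<3 ^ k})"
  proof (rule inj_onI)
    fix p p' assume mem: "p \<in> {..<3 ^ k} \<times> {..<3 ^ k}" "p' \<in> {..<3 ^ k} \<times> {..<3 ^ k}"
      and Meq: "(?M $$ p)\<^sup>2 = (?M $$ p')\<^sup>2"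
    obtain v w v' w' where p: "p = (v, w)" "p' = (v', w')"
      by (cases p; cases p')
    have lt: "v < 3 ^ k" "w < 3 ^ k" "v' < 3 ^ k" "w' < 3 ^ k"
      and eq: "(?M $$ (v, w))\<^sup>2 = (?M $$ (v', w'))\<^sup>2"
      using mem Meq by (simp_all add: p)
    \<comment> \<open>Restriction to \<open>{..<k}\<close> puts the tuple of positions into the
      extensional function space over which distinctness is stated.\<close>
    define z where "z = (\<lambda>v w. \<lambda>i\<in>{..<k}. (F3_to_nat ((L *\<^sub>v digits3 k v) $ i), F3_to_nat (digits3 k w $ i)))"
    have z: "(?M $$ (v, w))\<^sup>2 = (\<Prod>i<k. (A i $$ z v w i)\<^sup>2)" if "v < 3 ^ k" "w < 3 ^ k" for v w
      using that by (simp add: sq square_entry_def z_def)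
    have "z v w = z v' w'"
      using dist[unfolded distinct_square_products_def]
    proof (rule inj_onD)
      show "(\<Prod>i<k. (A i $$ z v w i)\<^sup>2) = (\<Prod>i<k. (A i $$ z v' w' i)\<^sup>2)"
        using eq lt by (simp add: z)
    qed (auto simp: z_def)
    then have "\<forall>i<k. (L *\<^sub>v digits3 k v) $ i = (L *\<^sub>v digits3 k v') $ i \<and> digits3 k w $ i = digits3 k w' $ i"
      by (auto simp: z_def fun_eq_iff split: if_splits)
    then have "\<forall>i<k. (L *\<^sub>v digits3 k v) $ i = (L *\<^sub>v digits3 k v') $ i" "digits3 k w = digits3 k w'"
      by (auto intro!: eq_vecI)
    then show "p = p'"
      using lt Linj inj_on_digits3[of k] by (simp add: p inj_on_eq_iff)
  qed
  ultimately show ?thesis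
    using carrier by (simp add: proper_euler_magic_def euler_magic_def)
qed

subsection \<open>Distinctness of products by valuations\<close>

text \<open>For prime \<open>p\<close> this is an integer combination of p-adic valuations, hence
  additive on products of positive integers. The weights let one functional distinguish several
  primes at once.\<close>

definition weighted_multiplicity :: "(nat \<times> int) list \<Rightarrow> nat \<Rightarrow> int" where
  "weighted_multiplicity ws n = (\<Sum>(p, w)\<leftarrow>ws. w * int (multiplicity p n))"

lemma weighted_multiplicity_Nil: "weighted_multiplicity [] n = 0"
  and weighted_multiplicity_Cons:
    "weighted_multiplicity ((p, w) # ws) n = w * int (multiplicity p n) + weighted_multiplicity ws n"
  by (simp_all add: weighted_multiplicity_def)

lemma weighted_multiplicity_mult:
  assumes "\<forall>p\<in>set (map fst ws). prime p" "m \<noteq> 0" "n \<noteq> 0"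
  shows "weighted_multiplicity ws (m * n) = weighted_multiplicity ws m + weighted_multiplicity ws n"
  using assms(1)
proof (induction ws)
  case (Cons pw ws)
  then show ?case
    using assms(2,3)
    by (cases pw) (simp add: weighted_multiplicity_Cons prime_elem_multiplicity_mult_distrib algebra_simps)
qed (simp add: weighted_multiplicity_Nil)

lemma weighted_multiplicity_prod_list:
  assumes "\<forall>p\<in>set (map fst ws). prime p" "0 \<notin> set ns"
  shows "weighted_multiplicity ws (prod_list ns) = (\<Sum>n\<leftarrow>ns. weighted_multiplicity ws n)"
  using assms(2)
proof (induction ns)
  case Nil
  show ?case by (induction ws) (auto simp: weighted_multiplicity_def)
next
  case (Cons n ns)
  then show ?case
    using assms(1) by (simp add: weighted_multiplicity_mult[OF assms(1)] prod_list_zero_iff del: neq0_conv)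
qed

text \<open>A rewrite rule that computes valuations of numerals by repeated division.\<close>

lemma multiplicity_rec:
  assumes "1 < p" "0 < (n :: nat)"
  shows "multiplicity p n = (if p dvd n then Suc (multiplicity p (n div p)) else 0)"
  using assms by (auto simp: multiplicity_times_same not_dvd_imp_multiplicity_0 elim!: dvdE)

text \<open>
  The \<open>i\<close>-th relation in a list of relations contains the pairs of positions that two tuples with
  equal products may still select in the \<open>i\<close>-th factor.  Since the differences of an additive
  functional (with values \<open>W\<close> at the positions) over all factors sum to zero, a pair can be
  discarded if its difference is not the negative of a sum of differences possible in the other
  factors.
\<close>

definition differences :: "int list \<Rightarrow> (nat \<times> nat) list \<Rightarrow> int list" where
  "differences W r = foldr (\<lambda>(a, b). List.insert (W ! a - W ! b)) r []"

text \<open>Duplicates are suppressed, so the lists grow only with the number of distinct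
  sums.\<close>

definition sumset :: "int list \<Rightarrow> int list \<Rightarrow> int list" where
  "sumset xs ys = foldr (\<lambda>x. foldr (\<lambda>y. List.insert (x + y)) ys) xs []"

text \<open>\<open>W ! b - W ! a\<close> is the negated difference of the pair. Factor
  \<open>i\<close> itself is left out of the sumset, and \<open>[0]\<close> is the sumset of no
  factors.\<close>

definition filter_relation :: "nat \<Rightarrow> int list \<Rightarrow> int list list \<Rightarrow> (nat \<times> nat) list list \<Rightarrow> (nat \<times> nat) list list" where
  "filter_relation i W Ds R = R[i := filter (\<lambda>(a, b). W ! b - W ! a \<in> set (foldr sumset (take i Ds @ drop (Suc i) Ds) [0])) (R ! i)]"

definition balance_filter :: "int list list \<Rightarrow> nat \<Rightarrow> (nat \<times> nat) list list \<Rightarrow> (nat \<times> nat) list list" where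
  "balance_filter Ws i R = filter_relation i (Ws ! i) (map2 differences Ws R) R"

text \<open>\<open>T\<close> is to list the absolute values of the entries of each factor. A step
  \<open>s\<close> pairs a functional, given by primes and weights, with the number of the factor to
  be filtered.\<close>

definition refine :: "nat list list \<Rightarrow> (nat \<times> int) list \<times> nat \<Rightarrow> (nat \<times> nat) list list \<Rightarrow> (nat \<times> nat) list list" where
  "refine T s R = balance_filter (map (map (weighted_multiplicity (fst s))) T) (snd s) R"

lemma set_differences: "set (differences W r) = (\<lambda>(a, b). W ! a - W ! b) ` set r"
  unfolding differences_def by (induction r) auto

lemma set_sumset: "set (sumset xs ys) = {x + y | x y. x \<in> set xs \<and> y \<in> set ys}"
proof -
  have "set (foldr (\<lambda>y. List.insert (x + y)) ys zs) = (+) x ` set ys \<union> set zs" for x zs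
    by (induction ys) auto
  then have "set (foldr (\<lambda>x. foldr (\<lambda>y. List.insert (x + y)) ys) xs zs) =
      {x + y | x y. x \<in> set xs \<and> y \<in> set ys} \<union> set zs" for zs
    by (induction xs) auto
  then show ?thesis
    by (simp add: sumset_def)
qed

lemma sum_list_in_sumset:
  assumes "list_all2 (\<lambda>d D. d \<in> set D) ds Ds"
  shows "sum_list ds \<in> set (foldr sumset Ds [0])"
  using assms by (induction rule: list_all2_induct) (auto simp: set_sumset)

text \<open>The differences of the pairs \<open>zs\<close> sum to zero, so those outside factor
  \<open>i\<close> sum to the negated difference at \<open>i\<close>. As this sum lies in the
  sumset, the pair at \<open>i\<close> survives.\<close>

lemma balance_filter:
  assumes zs: "list_all2 (\<lambda>z r. z \<in> set r) zs R"
    and len: "length Ws = length R" "i < length R"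
    and sum: "(\<Sum>(W, a, b)\<leftarrow>zip Ws zs. W ! a - W ! b) = 0"
  shows "list_all2 (\<lambda>z r. z \<in> set r) zs (balance_filter Ws i R)"
proof -
  define ds where "ds = map (\<lambda>(W, a, b). W ! a - W ! b) (zip Ws zs)"
  define Ds where "Ds = map2 differences Ws R"
  have zslen: "length zs = length R"
    using zs by (rule list_all2_lengthD)
  have ds_nth: "ds ! j = Ws ! j ! fst (zs ! j) - Ws ! j ! snd (zs ! j)" if "j < length R" for j
    using that len zslen by (simp add: ds_def split_def)
  have "list_all2 (\<lambda>d D. d \<in> set D) ds Ds"
    using zs len zslen
    by (auto simp: list_all2_conv_all_nth ds_nth Ds_def ds_def set_differences image_iff split_def
        intro!: bexI[where x = "zs ! _"])
  then have "list_all2 (\<lambda>d D. d \<in> set D) (take i ds @ drop (Suc i) ds) (take i Ds @ drop (Suc i) Ds)"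
    by (intro list_all2_appendI list_all2_takeI list_all2_dropI)
  then have "sum_list (take i ds @ drop (Suc i) ds) \<in> set (foldr sumset (take i Ds @ drop (Suc i) Ds) [0])"
    by (rule sum_list_in_sumset)
  moreover have "sum_list (take i ds @ drop (Suc i) ds) = - (ds ! i)"
  proof -
    have "i < length ds" using len zslen by (simp add: ds_def)
    then have "sum_list ds = sum_list (take i ds) + ds ! i + sum_list (drop (Suc i) ds)"
      by (metis id_take_nth_drop sum_list.append sum_list.Cons add.assoc)
    then show ?thesis
      using sum by (simp add: ds_def)
  qed
  ultimately have "Ws ! i ! snd (zs ! i) - Ws ! i ! fst (zs ! i) \<in>
      set (foldr sumset (take i Ds @ drop (Suc i) Ds) [0])"
    using len by (simp add: ds_nth)
  moreover have "balance_filter Ws i R = filter_relation i (Ws ! i) Ds R"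
    by (simp add: balance_filter_def Ds_def)
  ultimately show ?thesis
    using zs len zslen
    by (auto simp: filter_relation_def list_all2_conv_all_nth nth_list_update split_def)
qed

text \<open>Equal products have the same value under the functional; by additivity this is the
  vanishing sum of differences that \<open>balance_filter\<close> requires.\<close>

lemma refine:
  assumes zs: "list_all2 (\<lambda>z r. z \<in> set r) zs R"
    and len: "length T = length R" "snd s < length R"
    and primes: "\<forall>p\<in>set (map fst (fst s)). prime p"
    and bounds: "list_all2 (\<lambda>(a, b) t. a < length t \<and> b < length t \<and> 0 \<notin> set t) zs T"
    and prod: "prod_list (map2 (\<lambda>(a, b) t. t ! a) zs T) = prod_list (map2 (\<lambda>(a, b) t. t ! b) zs T)"
  shows "list_all2 (\<lambda>z r. z \<in> set r) zs (refine T s R)"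
  unfolding refine_def
proof (rule balance_filter[OF zs])
  let ?\<phi> = "weighted_multiplicity (fst s)"
  have "(\<Sum>(W, a, b)\<leftarrow>zip (map (map ?\<phi>) T) zs. W ! a - W ! b) =
      (\<Sum>n\<leftarrow>map2 (\<lambda>(a, b) t. t ! a) zs T. ?\<phi> n) - (\<Sum>n\<leftarrow>map2 (\<lambda>(a, b) t. t ! b) zs T. ?\<phi> n)"
    using bounds by (induction rule: list_all2_induct) auto
  also have "\<dots> = ?\<phi> (prod_list (map2 (\<lambda>(a, b) t. t ! a) zs T)) -
      ?\<phi> (prod_list (map2 (\<lambda>(a, b) t. t ! b) zs T))"
  proof -
    \<comment> \<open>Additivity of valuations is available for nonzero numbers only, so no selected
      entry may be 0.\<close>
    have "0 < t ! a" if "a < length t" "0 \<notin> set t" for t :: "nat list" and a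
      using that nth_mem[of a t] by (cases "t ! a = 0") auto
    then have nz: "0 \<notin> set (map2 (\<lambda>(a, b) t. t ! a) zs T)" "0 \<notin> set (map2 (\<lambda>(a, b) t. t ! b) zs T)"
      using bounds by (force simp: list_all2_conv_all_nth set_zip)+
    show ?thesis
      by (simp only: weighted_multiplicity_prod_list[OF primes nz(1)]
          weighted_multiplicity_prod_list[OF primes nz(2)])
  qed
  finally show "(\<Sum>(W, a, b)\<leftarrow>zip (map (map ?\<phi>) T) zs. W ! a - W ! b) = 0"
    using prod by simp
qed (use len in simp_all)

lemma length_refine [simp]: "length (refine T s R) = length R"
  by (simp add: refine_def balance_filter_def filter_relation_def)

lemma fold_refine:
  assumes "list_all2 (\<lambda>z r. z \<in> set r) zs R"
    and "length T = length R"
    and "\<forall>s\<in>set C. snd s < length R \<and> (\<forall>p\<in>set (map fst (fst s)). prime p)"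
    and "list_all2 (\<lambda>(a, b) t. a < length t \<and> b < length t \<and> 0 \<notin> set t) zs T"
    and "prod_list (map2 (\<lambda>(a, b) t. t ! a) zs T) = prod_list (map2 (\<lambda>(a, b) t. t ! b) zs T)"
  shows "list_all2 (\<lambda>z r. z \<in> set r) zs (fold (refine T) C R)"
  using assms(1,2,3)
proof (induction C arbitrary: R)
  case (Cons s C)
  have "list_all2 (\<lambda>z r. z \<in> set r) zs (refine T s R)"
    using Cons.prems assms(4,5) by (intro refine) auto
  then show ?case
    using Cons.prems by (simp add: Cons.IH)
qed simp

section \<open>From certificates to distinct products of entry squares\<close>

definition factor_matrix :: "int list \<Rightarrow> int mat" where
  "factor_matrix xs = mat 3 3 (\<lambda>(i, j). xs ! (3 * i + j))"

lemma factor_matrix_carrier [simp]: "factor_matrix xs \<in> carrier_mat 3 3"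
  by (simp add: factor_matrix_def)

text \<open>Start from all 81 pairs of positions in every factor. The pairs selected by two tuples
  with equal products survive every step of the certificate \<open>C\<close>; if only pairs with
  equal components remain, the tuples agree.\<close>

lemma distinct_square_products_factor_matrix:
  fixes X :: "int list list"
  defines "T \<equiv> map (map (\<lambda>x. nat \<bar>x\<bar>)) X"
  assumes X: "\<forall>xs\<in>set X. length xs = 9 \<and> 0 \<notin> set xs"
    and C: "\<forall>s\<in>set C. snd s < length X \<and> (\<forall>p\<in>set (map fst (fst s)). prime p)"
    and diagonal: "\<forall>r\<in>set (fold (refine T) C (map (\<lambda>_. List.product [0..<9] [0..<9]) X)). \<forall>(a, b)\<in>set r. a = b"
  shows "distinct_square_products (length X) (\<lambda>i. factor_matrix (X ! i))"
  unfolding distinct_square_products_def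
proof (rule inj_onI)
  let ?k = "length X" and ?R = "map (\<lambda>_. List.product [0..<9] [0..<9]) X"
  fix z z' :: "nat \<Rightarrow> nat \<times> nat"
  assume z: "z \<in> {..<?k} \<rightarrow>\<^sub>E {..<3} \<times> {..<3}" and z': "z' \<in> {..<?k} \<rightarrow>\<^sub>E {..<3} \<times> {..<3}"
    and eq: "(\<Prod>i<?k. (factor_matrix (X ! i) $$ z i)\<^sup>2) = (\<Prod>i<?k. (factor_matrix (X ! i) $$ z' i)\<^sup>2)"
  \<comment> \<open>The row-major position of an entry in the list behind
    \<open>factor_matrix\<close>.\<close>
  define c :: "nat \<times> nat \<Rightarrow> nat" where "c = (\<lambda>(x, y). 3 * x + y)"
  define zs where "zs = map (\<lambda>i. (c (z i), c (z' i))) [0..<?k]"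
  have zi: "fst (z i) < 3" "snd (z i) < 3" "fst (z' i) < 3" "snd (z' i) < 3" if "i < ?k" for i
    using PiE_mem[OF z, of i] PiE_mem[OF z', of i] that by (auto simp: mem_Times_iff)
  have c: "c (z i) < 9" "c (z' i) < 9" if "i < ?k" for i
    using zi[OF that] by (auto simp: c_def split_def)
  have prod: "nat s = prod_list (map (\<lambda>i. T ! i ! c (y i)) [0..<?k])"
    if "\<And>i. i < ?k \<Longrightarrow> fst (y i) < 3 \<and> snd (y i) < 3"
      "s = \<bar>\<Prod>i<?k. factor_matrix (X ! i) $$ y i\<bar>" for y s
  proof -
    have "int (T ! i ! c (y i)) = \<bar>factor_matrix (X ! i) $$ y i\<bar>" if i: "i < ?k" for i
    proof -
      have "c (y i) < length (X ! i)"
        using \<open>\<And>i. i < ?k \<Longrightarrow> fst (y i) < 3 \<and> snd (y i) < 3\<close>[OF i] X i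
        by (auto simp: c_def split_def)
      then show ?thesis
        using \<open>\<And>i. i < ?k \<Longrightarrow> fst (y i) < 3 \<and> snd (y i) < 3\<close>[OF i] i
        by (cases "y i") (simp add: T_def factor_matrix_def c_def)
    qed
    then have "s = (\<Prod>i<?k. int (T ! i ! c (y i)))"
      unfolding that(2) abs_prod by (intro prod.cong) auto
    then show ?thesis
      by (simp add: interv_sum_list_conv_sum_set_nat prod.list_conv_set_nth atLeast0LessThan
          flip: of_nat_prod)
  qed
  \<comment> \<open>Equal squares mean equal absolute values, and the relations are refined for the
    latter.\<close>
  have "(\<Prod>i<?k. factor_matrix (X ! i) $$ z i)\<^sup>2 = (\<Prod>i<?k. factor_matrix (X ! i) $$ z' i)\<^sup>2"
    using eq by (simp add: prod_power_distrib)
  then have "\<bar>\<Prod>i<?k. factor_matrix (X ! i) $$ z i\<bar> = \<bar>\<Prod>i<?k. factor_matrix (X ! i) $$ z' i\<bar>"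
    by (simp add: power2_eq_iff abs_eq_iff)
  then have prods: "prod_list (map (\<lambda>i. T ! i ! c (z i)) [0..<?k]) = prod_list (map (\<lambda>i. T ! i ! c (z' i)) [0..<?k])"
    using prod[of z] prod[of z'] zi by simp
  have "list_all2 (\<lambda>z r. z \<in> set r) zs (fold (refine T) C ?R)"
  proof (rule fold_refine)
    show "list_all2 (\<lambda>z r. z \<in> set r) zs ?R"
      using c by (auto simp: list_all2_conv_all_nth zs_def)
    show "list_all2 (\<lambda>(a, b) t. a < length t \<and> b < length t \<and> 0 \<notin> set t) zs T"
      using c X by (auto simp: list_all2_conv_all_nth zs_def T_def image_iff)
    have "map2 (\<lambda>(a, b) t. t ! a) zs T = map (\<lambda>i. T ! i ! c (z i)) [0..<?k]"
      "map2 (\<lambda>(a, b) t. t ! b) zs T = map (\<lambda>i. T ! i ! c (z' i)) [0..<?k]"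
      by (auto simp: zs_def T_def intro!: nth_equalityI)
    then show "prod_list (map2 (\<lambda>(a, b) t. t ! a) zs T) = prod_list (map2 (\<lambda>(a, b) t. t ! b) zs T)"
      using prods by simp
  qed (use C in \<open>auto simp: T_def\<close>)
  then have R: "zs ! i \<in> set (fold (refine T) C ?R ! i)" "i < length (fold (refine T) C ?R)" if "i < ?k" for i
    using that by (simp_all add: list_all2_conv_all_nth zs_def)
  have "z i = z' i" if i: "i < ?k" for i
  proof -
    have "c (z i) = c (z' i)"
      using bspec[OF bspec[OF diagonal nth_mem[OF R(2)[OF i]]] R(1)[OF i]] i by (simp add: zs_def)
    then have "3 * fst (z i) + snd (z i) = 3 * fst (z' i) + snd (z' i)"
      by (simp add: c_def split_def)
    then have "fst (z i) = fst (z' i) \<and> snd (z i) = snd (z' i)"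
      using zi[OF i] by presburger
    then show ?thesis
      by (simp add: prod_eq_iff)
  qed
  then show "z = z'"
    using z z' by (intro PiE_ext) auto
qed

text \<open>The bound is \<open>23\<^sup>2\<close>, where 23 is the first prime not tried.\<close>

lemma prime_nat_trial_division:
  fixes p :: nat
  assumes "1 < p" "p < 529" "\<forall>q\<in>set [2, 3, 5, 7, 11, 13, 17, 19]. q dvd p \<longrightarrow> p = q"
  shows "prime p"
  unfolding prime_nat_iff'
proof (intro conjI ballI notI)
  fix n assume n: "n \<in> {2..<p}" "n dvd p"
  then obtain m where m: "p = n * m" by auto
  \<comment> \<open>A divisor and its cofactor cannot both be at least 23, since their product is
    below 529.\<close>
  have "\<exists>d. 2 \<le> d \<and> d < 23 \<and> d < p \<and> d dvd p"
  proof (cases "n < 23")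
    case False
    have "m < 23"
    proof (rule ccontr)
      assume "\<not> m < 23"
      then have "23 * 23 \<le> n * m"
        using False by (intro mult_mono) auto
      then show False
        using assms(2) m by simp
    qed
    moreover have "m \<noteq> 0" "m \<noteq> 1"
      using n(1) m by auto
    moreover have "m < p"
      using m n(1) \<open>m \<noteq> 0\<close> by simp
    ultimately show ?thesis
      using m by (intro exI[of _ m]) auto
  qed (use n in auto)
  then obtain d where d: "2 \<le> d" "d < 23" "d < p" "d dvd p"
    by blast
  have "\<forall>d\<in>{2..<23}. \<exists>q\<in>set [2, 3, 5, 7, 11, 13, 17, 19]. q dvd (d :: nat)"
    by (simp add: atLeastLessThan_nat_numeral ball_Un)
  moreover have "d \<in> {2..<23}"
    using d(1,2) by simp
  ultimately obtain q where q: "q \<in> set [2, 3, 5, 7, 11, 13, 17, 19]" "q dvd d"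
    by blast
  then have "p = q"
    using assms(3) d(4) dvd_trans by blast
  then show False
    using q(2) d(1,3) dvd_imp_le[of q d] by simp
qed (use assms(1) in simp)

lemma upt_0_9: "[0..<9] = [0, 1, 2, 3, 4, 5, 6, 7, 8]"
  by (simp add: upt_rec)

subsection \<open>Diagonal sums of semimagic squares\<close>

lemma F3_numerals: "(3 :: 3) = 0" "(4 :: 3) = 1" "(5 :: 3) = 2" "(6 :: 3) = 0"
  by simp_all

definition semimagic :: "(3 \<Rightarrow> 3 \<Rightarrow> int) \<Rightarrow> int \<Rightarrow> bool" where
  "semimagic F \<alpha> \<longleftrightarrow> (\<forall>r. (\<Sum>c\<in>UNIV. F r c) = \<alpha>) \<and> (\<forall>c. (\<Sum>r\<in>UNIV. F r c) = \<alpha>)"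

text \<open>The upper left 2 by 2 corner and the constant determine a semimagic square of order 3.
  Substitution turns the block sums below into polynomial identities in free variables.\<close>

lemma semimagic_entries:
  assumes "semimagic F \<alpha>"
  shows "F 0 2 = \<alpha> - F 0 0 - F 0 1" "F 1 2 = \<alpha> - F 1 0 - F 1 1"
    "F 2 0 = \<alpha> - F 0 0 - F 1 0" "F 2 1 = \<alpha> - F 0 1 - F 1 1"
    "F 2 2 = F 0 0 + F 0 1 + F 1 0 + F 1 1 - \<alpha>"
proof -
  have "F r 0 + F r 1 + F r 2 = \<alpha>" "F 0 c + F 1 c + F 2 c = \<alpha>" for r c
    using assms by (simp_all add: semimagic_def sum_F3)
  from this(1)[of 0] this(1)[of 1] this(1)[of 2] this(2)[of 0] this(2)[of 1]
  show "F 0 2 = \<alpha> - F 0 0 - F 0 1" "F 1 2 = \<alpha> - F 1 0 - F 1 1"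
    "F 2 0 = \<alpha> - F 0 0 - F 1 0" "F 2 1 = \<alpha> - F 0 1 - F 1 1"
    "F 2 2 = F 0 0 + F 0 1 + F 1 0 + F 1 1 - \<alpha>"
    by linarith+
qed

text \<open>A semimagic square has no Fourier coefficient at characters nontrivial in exactly one
  index. Among the remaining pairs of characters for \<open>F\<close> and \<open>G\<close>, only the
  trivial pair restricts to the trivial character of \<open>(x, y)\<close>, and it contributes
  \<open>\<alpha> * \<beta>\<close>. The proof itself expands everything in the free
  entries.\<close>

lemma sum_block2:
  assumes "semimagic F \<alpha>" "semimagic G \<beta>"
  shows "(\<Sum>x\<in>UNIV. \<Sum>y\<in>UNIV. F (x + y) x * G (x + 2 * y) y) = \<alpha> * \<beta>"
  by (simp add: sum_F3 F3_numerals semimagic_entries[OF assms(1)] semimagic_entries[OF assms(2)] algebra_simps)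

text \<open>The same character argument applies: the variable \<open>z\<close> makes the characters
  of \<open>F\<close> and \<open>H\<close> trivial or nontrivial together, and \<open>x\<close> and
  \<open>y\<close> then exclude every nontrivial triple.\<close>

lemma sum_block3:
  assumes "semimagic F \<alpha>" "semimagic G \<beta>" "semimagic H \<gamma>"
  shows "(\<Sum>x\<in>UNIV. \<Sum>y\<in>UNIV. \<Sum>z\<in>UNIV. F z x * G (x + y) y * H (x + 2 * y) z) = \<alpha> * \<beta> * \<gamma>"
  by (simp add: sum_F3 F3_numerals semimagic_entries[OF assms(1)] semimagic_entries[OF assms(2)]
      semimagic_entries[OF assms(3)] algebra_simps)


section \<open>Linear maps that balance both diagonals\<close>

definition digit_sum :: "nat \<Rightarrow> (3 vec \<Rightarrow> int) \<Rightarrow> int" where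
  "digit_sum k g = (\<Sum>n<3 ^ k. g (digits3 k n))"

lemma digit_sum_Suc: "digit_sum (Suc k) g = (\<Sum>a\<in>UNIV. digit_sum k (\<lambda>v. g (vCons a v)))"
  unfolding digit_sum_def by (rule sum_digits3_Suc)

lemma digit_sum_0: "digit_sum 0 g = g vNil"
  by (simp add: digit_sum_def digits3_0)

definition rows_mat :: "nat \<Rightarrow> 3 list list \<Rightarrow> 3 mat" where
  "rows_mat k rs = mat k k (\<lambda>(i, j). rs ! i ! j)"

lemma rows_mat_carrier [simp]: "rows_mat k rs \<in> carrier_mat k k"
  by (simp add: rows_mat_def)


lemma rows_mat_mult_vec:
  assumes "i < k" "dim_vec v = k"
  shows "(rows_mat k rs *\<^sub>v v) $ i = (\<Sum>j<k. rs ! i ! j * v $ j)"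
  using assms by (simp add: rows_mat_def scalar_prod_def atLeast0LessThan)

lemma invertible_rows_mat:
  assumes "rows_mat k rs * rows_mat k ss = 1\<^sub>m k" "rows_mat k ss * rows_mat k rs = 1\<^sub>m k"
  shows "invertible_mat (rows_mat k rs)"
  using assms by (auto simp: invertible_mat_def inverts_mat_def square_mat.simps rows_mat_def)

text \<open>Arbitrary semimagic squares are allowed, so that reflecting their columns yields the
  antidiagonal sum from the same property.\<close>

definition diagonally_balanced :: "nat \<Rightarrow> 3 mat \<Rightarrow> bool" where
  "diagonally_balanced k L \<longleftrightarrow>
     (\<forall>F \<alpha>. (\<forall>i<k. semimagic (F i) (\<alpha> i)) \<longrightarrow>
       (\<Sum>n<3 ^ k. \<Prod>i<k. F i ((L *\<^sub>v digits3 k n) $ i) (digits3 k n $ i)) = (\<Prod>i<k. \<alpha> i))"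

text \<open>Three copies of the block \<open>(x, y) \<mapsto> (x + y, x + 2 * y)\<close> of
  \<open>sum_block2\<close>.\<close>

definition L6 :: "3 mat" where
  "L6 = rows_mat 6
    [[1, 1, 0, 0, 0, 0],
     [1, 2, 0, 0, 0, 0],
     [0, 0, 1, 1, 0, 0],
     [0, 0, 1, 2, 0, 0],
     [0, 0, 0, 0, 1, 1],
     [0, 0, 0, 0, 1, 2]]"

text \<open>Each block has determinant 1, and its inverse modulo 3 is
  \<open>[[2, 2], [2, 1]]\<close>.\<close>

lemma invertible_L6: "invertible_mat L6"
  unfolding L6_def
  by (rule invertible_rows_mat[where ss =
     "[[2, 2, 0, 0, 0, 0],
       [2, 1, 0, 0, 0, 0],
       [0, 0, 2, 2, 0, 0],
       [0, 0, 2, 1, 0, 0],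
       [0, 0, 0, 0, 2, 2],
       [0, 0, 0, 0, 2, 1]]"]; rule eq_matI)
    (auto simp: rows_mat_def scalar_prod_def less_Suc_eq numeral_eq_Suc F3_numerals)

lemma digit_sum_6:
  "digit_sum 6 g = (\<Sum>a\<in>UNIV. \<Sum>b\<in>UNIV. \<Sum>c\<in>UNIV. \<Sum>d\<in>UNIV. \<Sum>e\<in>UNIV. \<Sum>f\<in>UNIV.
     g (vCons a (vCons b (vCons c (vCons d (vCons e (vCons f vNil)))))))"
  by (simp add: eval_nat_numeral digit_sum_Suc digit_sum_0)

lemma L6_mult_vec:
  fixes a b c d e f :: 3
  defines "v \<equiv> vCons a (vCons b (vCons c (vCons d (vCons e (vCons f vNil)))))"
  shows "(L6 *\<^sub>v v) $ 0 = a + b" "(L6 *\<^sub>v v) $ 1 = a + 2 * b"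
    "(L6 *\<^sub>v v) $ 2 = c + d" "(L6 *\<^sub>v v) $ 3 = c + 2 * d"
    "(L6 *\<^sub>v v) $ 4 = e + f" "(L6 *\<^sub>v v) $ 5 = e + 2 * f"
    "v $ 0 = a" "v $ 1 = b" "v $ 2 = c" "v $ 3 = d" "v $ 4 = e" "v $ 5 = f"
  by (simp_all add: L6_def v_def rows_mat_mult_vec lessThan_nat_numeral vec_index_vCons)

text \<open>The bracketing follows the blocks of \<open>L6\<close>, so that the nested sum over six
  digits factors into one double sum per block.\<close>

lemma prod_lessThan_6:
  fixes f :: "nat \<Rightarrow> int"
  shows "(\<Prod>i<6. f i) = (f 0 * f 1) * ((f 2 * f 3) * (f 4 * f 5))"
  by (simp add: lessThan_nat_numeral ac_simps)

lemma diagonally_balanced_L6: "diagonally_balanced 6 L6"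
  unfolding diagonally_balanced_def
proof (intro allI impI)
  fix F :: "nat \<Rightarrow> 3 \<Rightarrow> 3 \<Rightarrow> int" and \<alpha> :: "nat \<Rightarrow> int"
  assume "\<forall>i<6. semimagic (F i) (\<alpha> i)"
  then have F: "semimagic (F 0) (\<alpha> 0)" "semimagic (F 1) (\<alpha> 1)" "semimagic (F 2) (\<alpha> 2)"
    "semimagic (F 3) (\<alpha> 3)" "semimagic (F 4) (\<alpha> 4)" "semimagic (F 5) (\<alpha> 5)"
    by auto
  have "digit_sum 6 (\<lambda>v. \<Prod>i<6. F i ((L6 *\<^sub>v v) $ i) (v $ i)) = (\<Prod>i<6. \<alpha> i)"
    unfolding digit_sum_6 prod_lessThan_6 L6_mult_vec
    by (simp only: sum_distrib_left[symmetric] sum_distrib_right[symmetric]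
        sum_block2[OF F(1,2)] sum_block2[OF F(3,4)] sum_block2[OF F(5,6)])
  then show "(\<Sum>n<3 ^ 6. \<Prod>i<6. F i ((L6 *\<^sub>v digits3 6 n) $ i) (digits3 6 n $ i)) = (\<Prod>i<6. \<alpha> i)"
    by (simp only: digit_sum_def)
qed

text \<open>Since 7 = 2 + 2 + 3, two blocks of \<open>sum_block2\<close> are followed by the block
  \<open>(e, f, h) \<mapsto> (h, e + f, e + 2 * f)\<close> of \<open>sum_block3\<close>.\<close>

definition L7 :: "3 mat" where
  "L7 = rows_mat 7
    [[1, 1, 0, 0, 0, 0, 0],
     [1, 2, 0, 0, 0, 0, 0],
     [0, 0, 1, 1, 0, 0, 0],
     [0, 0, 1, 2, 0, 0, 0],
     [0, 0, 0, 0, 0, 0, 1],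
     [0, 0, 0, 0, 1, 1, 0],
     [0, 0, 0, 0, 1, 2, 0]]"

lemma invertible_L7: "invertible_mat L7"
  unfolding L7_def
  by (rule invertible_rows_mat[where ss =
     "[[2, 2, 0, 0, 0, 0, 0],
       [2, 1, 0, 0, 0, 0, 0],
       [0, 0, 2, 2, 0, 0, 0],
       [0, 0, 2, 1, 0, 0, 0],
       [0, 0, 0, 0, 0, 2, 2],
       [0, 0, 0, 0, 0, 2, 1],
       [0, 0, 0, 0, 1, 0, 0]]"]; rule eq_matI)
    (auto simp: rows_mat_def scalar_prod_def less_Suc_eq numeral_eq_Suc F3_numerals)

lemma digit_sum_7:
  "digit_sum 7 g = (\<Sum>a\<in>UNIV. \<Sum>b\<in>UNIV. \<Sum>c\<in>UNIV. \<Sum>d\<in>UNIV. \<Sum>e\<in>UNIV. \<Sum>f\<in>UNIV. \<Sum>h\<in>UNIV.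
     g (vCons a (vCons b (vCons c (vCons d (vCons e (vCons f (vCons h vNil))))))))"
  by (simp add: eval_nat_numeral digit_sum_Suc digit_sum_0)

lemma L7_mult_vec:
  fixes a b c d e f h :: 3
  defines "v \<equiv> vCons a (vCons b (vCons c (vCons d (vCons e (vCons f (vCons h vNil))))))"
  shows "(L7 *\<^sub>v v) $ 0 = a + b" "(L7 *\<^sub>v v) $ 1 = a + 2 * b"
    "(L7 *\<^sub>v v) $ 2 = c + d" "(L7 *\<^sub>v v) $ 3 = c + 2 * d"
    "(L7 *\<^sub>v v) $ 4 = h" "(L7 *\<^sub>v v) $ 5 = e + f" "(L7 *\<^sub>v v) $ 6 = e + 2 * f"
    "v $ 0 = a" "v $ 1 = b" "v $ 2 = c" "v $ 3 = d" "v $ 4 = e" "v $ 5 = f" "v $ 6 = h"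
  by (simp_all add: L7_def v_def rows_mat_mult_vec lessThan_nat_numeral vec_index_vCons)

lemma prod_lessThan_7:
  fixes f :: "nat \<Rightarrow> int"
  shows "(\<Prod>i<7. f i) = (f 0 * f 1) * ((f 2 * f 3) * (f 4 * f 5 * f 6))"
  by (simp add: lessThan_nat_numeral ac_simps)

lemma diagonally_balanced_L7: "diagonally_balanced 7 L7"
  unfolding diagonally_balanced_def
proof (intro allI impI)
  fix F :: "nat \<Rightarrow> 3 \<Rightarrow> 3 \<Rightarrow> int" and \<alpha> :: "nat \<Rightarrow> int"
  assume "\<forall>i<7. semimagic (F i) (\<alpha> i)"
  then have F: "semimagic (F 0) (\<alpha> 0)" "semimagic (F 1) (\<alpha> 1)" "semimagic (F 2) (\<alpha> 2)"
    "semimagic (F 3) (\<alpha> 3)" "semimagic (F 4) (\<alpha> 4)" "semimagic (F 5) (\<alpha> 5)" "semimagic (F 6) (\<alpha> 6)"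
    by auto
  have "digit_sum 7 (\<lambda>v. \<Prod>i<7. F i ((L7 *\<^sub>v v) $ i) (v $ i)) = (\<Prod>i<7. \<alpha> i)"
    unfolding digit_sum_7 prod_lessThan_7 L7_mult_vec
    by (simp only: sum_distrib_left[symmetric] sum_distrib_right[symmetric]
        sum_block2[OF F(1,2)] sum_block2[OF F(3,4)] sum_block3[OF F(5,6,7)])
  then show "(\<Sum>n<3 ^ 7. \<Prod>i<7. F i ((L7 *\<^sub>v digits3 7 n) $ i) (digits3 7 n $ i)) = (\<Prod>i<7. \<alpha> i)"
    by (simp only: digit_sum_def)
qed

subsection \<open>Factors from quaternions\<close>

text \<open>The Euler-Rodrigues formula: with q = a + bi + cj + dk, this is the row-major matrix of
  conjugation v \<mapsto> q v q* on imaginary quaternions, where q* is the conjugate of q. It is the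
  norm of q times a rotation.\<close>

fun rotation_entries :: "int \<times> int \<times> int \<times> int \<Rightarrow> int list" where
  "rotation_entries (a, b, c, d) =
    [a\<^sup>2 + b\<^sup>2 - c\<^sup>2 - d\<^sup>2, 2 * (b * c - a * d), 2 * (b * d + a * c),
     2 * (b * c + a * d), a\<^sup>2 - b\<^sup>2 + c\<^sup>2 - d\<^sup>2, 2 * (c * d - a * b),
     2 * (b * d - a * c), 2 * (c * d + a * b), a\<^sup>2 - b\<^sup>2 - c\<^sup>2 + d\<^sup>2]"

fun quaternion_norm :: "int \<times> int \<times> int \<times> int \<Rightarrow> int" where
  "quaternion_norm (a, b, c, d) = a\<^sup>2 + b\<^sup>2 + c\<^sup>2 + d\<^sup>2"

lemma orthogonality_factor_rotation:
  assumes "quaternion_norm q \<noteq> 0"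
  shows "orthogonality_factor 3 (factor_matrix (rotation_entries q)) ((quaternion_norm q)\<^sup>2)"
proof -
  obtain a b c d where q: "q = (a, b, c, d)"
    by (cases q)
  have "factor_matrix (rotation_entries q) * transpose_mat (factor_matrix (rotation_entries q)) =
      (quaternion_norm q)\<^sup>2 \<cdot>\<^sub>m 1\<^sub>m 3"
    by (rule eq_matI) (auto simp: q factor_matrix_def scalar_prod_def less_Suc_eq numeral_3_eq_3
        nth_Cons' power2_eq_square algebra_simps)
  then show ?thesis
    using assms by (simp add: orthogonality_factor_def)
qed

text \<open>Rows and columns of a scaled rotation all have the same length, namely the norm of
  \<open>q\<close>.\<close>

lemma semimagic_rotation:
  "semimagic (square_entry (factor_matrix (rotation_entries q))) ((quaternion_norm q)\<^sup>2)"
proof -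
  obtain a b c d where q: "q = (a, b, c, d)"
    by (cases q)
  let ?F = "square_entry (factor_matrix (rotation_entries q))"
  have "?F r 0 + ?F r 1 + ?F r 2 = (quaternion_norm q)\<^sup>2 \<and> ?F 0 r + ?F 1 r + ?F 2 r = (quaternion_norm q)\<^sup>2" for r
    using F3_exhaust[of r]
    by (elim disjE) (simp_all add: q square_entry_def factor_matrix_def power2_eq_square algebra_simps)
  then show ?thesis
    by (simp add: semimagic_def sum_F3)
qed

lemma semimagic_reflect: "semimagic F \<alpha> \<Longrightarrow> semimagic (\<lambda>r c. F r (2 - c)) \<alpha>"
  by (auto simp: semimagic_def sum_F3 algebra_simps)

lemma proper_euler_magic_rotations:
  fixes Q :: "(int \<times> int \<times> int \<times> int) list"
  assumes dist: "distinct_square_products k (\<lambda>i. factor_matrix (map rotation_entries Q ! i))"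
    and Q: "length Q = k" "\<forall>q\<in>set Q. quaternion_norm q \<noteq> 0"
    and L: "L \<in> carrier_mat k k" "invertible_mat L" "diagonally_balanced k L"
  shows "\<exists>(A :: nat \<Rightarrow> int mat) (L :: 3 mat).
    (\<forall>i<k. \<exists>\<gamma>. orthogonality_factor 3 (A i) \<gamma>) \<and>
    distinct_square_products k A \<and>
    L \<in> carrier_mat k k \<and> invertible_mat L \<and>
    proper_euler_magic (3 ^ k) (\<Prod>i<k. (quaternion_norm (Q ! i))\<^sup>2) (reindexed_tensor k L A)"
proof -
  let ?A = "\<lambda>i. factor_matrix (map rotation_entries Q ! i)"
  let ?\<gamma> = "\<lambda>i. (quaternion_norm (Q ! i))\<^sup>2"
  have orth: "orthogonality_factor 3 (?A i) (?\<gamma> i)" and magic: "semimagic (square_entry (?A i)) (?\<gamma> i)"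
    if "i < k" for i
    using that Q by (simp_all add: orthogonality_factor_rotation semimagic_rotation)
  have balanced: "(\<Sum>n<3 ^ k. \<Prod>i<k. F i ((L *\<^sub>v digits3 k n) $ i) (digits3 k n $ i)) = (\<Prod>i<k. ?\<gamma> i)"
    if "\<And>i. i < k \<Longrightarrow> semimagic (F i) (?\<gamma> i)" for F
    using that by (rule L(3)[unfolded diagonally_balanced_def, rule_format, where \<alpha> = ?\<gamma>])
  have all_orth: "\<forall>i<k. \<exists>\<gamma>. orthogonality_factor 3 (?A i) \<gamma>"
    using orth by blast
  have proper: "proper_euler_magic (3 ^ k) (\<Prod>i<k. ?\<gamma> i) (reindexed_tensor k L ?A)"
    using orth dist L(1,2)
  proof (rule proper_euler_magic_reindexed_tensor)
    show "(\<Sum>n<3 ^ k. \<Prod>i<k. square_entry (?A i) ((L *\<^sub>v digits3 k n) $ i) (digits3 k n $ i)) = (\<Prod>i<k. ?\<gamma> i)"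
      by (rule balanced) (rule magic)
    show "(\<Sum>n<3 ^ k. \<Prod>i<k. square_entry (?A i) ((L *\<^sub>v digits3 k n) $ i) (2 - digits3 k n $ i)) = (\<Prod>i<k. ?\<gamma> i)"
      \<comment> \<open>The antidiagonal sum is the diagonal sum for the squares with reflected
        columns.\<close>
      by (rule balanced[where F = "\<lambda>i r c. square_entry (?A i) r (2 - c)"])
        (rule semimagic_reflect, rule magic)
  qed
  show ?thesis
    by (rule exI[of _ ?A], rule exI[of _ L], intro conjI)
      (fact all_orth, fact dist, fact L(1), fact L(2), fact proper)
qed

section \<open>The concrete factors and their certificates\<close>

lemmas checker_defs =
  upt_0_9 refine_def balance_filter_def filter_relation_def differences_def sumset_def List.insert_def
  weighted_multiplicity_Cons weighted_multiplicity_Nil multiplicity_rec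

text \<open>The norms are 57, 399, 231, 95, 507 and 147. Their product 37197061316415 is the square
  root of the constant for order 729.\<close>

definition quaternions6 :: "(int \<times> int \<times> int \<times> int) list" where
  "quaternions6 = [(6, 4, 2, 1), (17, 7, 6, 5), (14, 5, 3, 1), (7, 6, 3, 1), (17, 11, 9, 4), (8, 7, 5, 3)]"

text \<open>
  The first steps use primes dividing entries of a single factor only; the weights are chosen to keep
  entries with different valuations apart.
\<close>

definition certificate6 :: "((nat \<times> int) list \<times> nat) list" where
  "certificate6 =
    [([(17, 1), (23, 2)], 0),
     ([(43, 1), (89, 2), (127, 3), (137, 4), (149, 5), (229, 6), (251, 7), (277, 8)], 1),
     ([(29, 1), (37, 2), (73, 3), (163, 4), (179, 5), (211, 6)], 2),
     ([(3, 3), (5, 2)], 3),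
     ([(103, 1), (109, 2), (151, 3), (167, 4), (197, 5), (223, 6), (233, 7), (313, 8)], 4),
     ([(19, 1), (41, 2), (59, 3), (61, 4), (71, 5), (79, 6)], 5),
     ([(67, 1)], 2),
     ([(31, 1)], 5),
     ([(2, 1)], 0),
     ([(2, 1), (7, 4), (11, 16), (13, 64)], 0),
     ([(47, 1)], 2),
     ([(13, 1)], 3),
     ([(11, 1)], 5)]"

lemma distinct_square_products_quaternions6:
  "distinct_square_products 6 (\<lambda>i. factor_matrix (map rotation_entries quaternions6 ! i))"
proof -
  let ?X = "map rotation_entries quaternions6"
  have "distinct_square_products (length ?X) (\<lambda>i. factor_matrix (?X ! i))"
  proof (rule distinct_square_products_factor_matrix[where C = certificate6])
    show "\<forall>xs\<in>set ?X. length xs = 9 \<and> 0 \<notin> set xs"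
      by (simp add: quaternions6_def)
    show "\<forall>s\<in>set certificate6. snd s < length ?X \<and> (\<forall>p\<in>set (map fst (fst s)). prime p)"
      by (simp add: certificate6_def quaternions6_def prime_nat_trial_division del: prime_nat_numeral_eq)
    have T: "map (map (\<lambda>x. nat \<bar>x\<bar>)) ?X =
      [[47, 4, 32, 28, 23, 44, 16, 52, 17],
       [277, 86, 274, 254, 251, 178, 134, 298, 229],
       [211, 2, 94, 58, 179, 134, 74, 146, 163],
       [75, 22, 54, 50, 21, 78, 30, 90, 5],
       [313, 62, 394, 334, 233, 302, 218, 446, 103],
       [79, 22, 122, 118, 31, 82, 38, 142, 1]]"
      by (simp add: quaternions6_def)
    have R: "map (\<lambda>_. p) ?X = [p, p, p, p, p, p]" for p :: "(nat \<times> nat) list"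
      by (simp add: quaternions6_def)
    show "\<forall>r\<in>set (fold (refine (map (map (\<lambda>x. nat \<bar>x\<bar>)) ?X)) certificate6
        (map (\<lambda>_. List.product [0..<9] [0..<9]) ?X)). \<forall>(a, b)\<in>set r. a = b"
      \<comment> \<open>Evaluating all steps of the certificate leaves only pairs with equal
        components.\<close>
      unfolding T R by (simp add: certificate6_def checker_defs)
  qed
  moreover have "length ?X = 6"
    by (simp add: quaternions6_def)
  ultimately show ?thesis
    by (simp only:)
qed

text \<open>The norms are 147, 699, 399, 57, 231, 723 and 95. Their product 37077986700011565 is the
  square root of the constant for order 2187.\<close>

definition quaternions7 :: "(int \<times> int \<times> int \<times> int) list" where
  "quaternions7 = [(8, 7, 5, 3), (16, 15, 13, 7), (18, 7, 5, 1), (6, 4, 2, 1), (14, 5, 3, 1), (17, 16, 13, 3), (7, 6, 3, 1)]"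

text \<open>The first six steps use primes that occur in one factor only, and they settle the
  factors 1 and 5. The primes 83 and 37, which these share with the factors 2 and 4, then become
  usable. The step with six primes settles factor 3, and the last four steps remove the ambiguities
  left in the factors 2, 0, 4 and 6.\<close>

definition certificate7 :: "((nat \<times> int) list \<times> nat) list" where
  "certificate7 =
    [([(19, 1), (31, 2), (41, 3), (59, 4), (61, 5), (71, 6), (79, 7)], 0),
     ([(89, 1), (103, 2), (149, 3), (151, 4), (263, 5), (307, 6), (313, 7), (331, 8)], 1),
     ([(53, 1), (97, 2), (131, 3), (251, 4), (347, 5)], 2),
     ([(29, 1), (67, 2), (73, 3), (163, 4), (179, 5), (211, 6)], 4),
     ([(127, 1), (157, 2), (173, 3), (193, 4), (233, 5), (269, 6), (311, 7), (367, 8)], 5),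
     ([(3, 3), (5, 1)], 6),
     ([(83, 1)], 2),
     ([(37, 1)], 4),
     ([(2, 1), (7, 5), (11, 25), (13, 125), (17, 625), (23, 3125)], 3),
     ([(17, 1), (23, 2)], 2),
     ([(11, 1)], 0),
     ([(47, 1)], 4),
     ([(13, 1)], 6)]"

lemma distinct_square_products_quaternions7:
  "distinct_square_products 7 (\<lambda>i. factor_matrix (map rotation_entries quaternions7 ! i))"
proof -
  let ?X = "map rotation_entries quaternions7"
  have "distinct_square_products (length ?X) (\<lambda>i. factor_matrix (?X ! i))"
  proof (rule distinct_square_products_factor_matrix[where C = certificate7])
    show "\<forall>xs\<in>set ?X. length xs = 9 \<and> 0 \<notin> set xs"
      by (simp add: quaternions7_def)
    show "\<forall>s\<in>set certificate7. snd s < length ?X \<and> (\<forall>p\<in>set (map fst (fst s)). prime p)"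
      by (simp add: certificate7_def quaternions7_def prime_nat_trial_division del: prime_nat_numeral_eq)
    have T: "map (map (\<lambda>x. nat \<bar>x\<bar>)) ?X =
      [[79, 22, 122, 118, 31, 82, 38, 142, 1],
       [263, 166, 626, 614, 151, 298, 206, 662, 89],
       [347, 34, 194, 106, 299, 242, 166, 262, 251],
       [47, 4, 32, 28, 23, 44, 16, 52, 17],
       [211, 2, 94, 58, 179, 134, 74, 146, 163],
       [367, 314, 538, 518, 193, 466, 346, 622, 127],
       [75, 22, 54, 50, 21, 78, 30, 90, 5]]"
      by (simp add: quaternions7_def)
    have R: "map (\<lambda>_. p) ?X = [p, p, p, p, p, p, p]" for p :: "(nat \<times> nat) list"
      by (simp add: quaternions7_def)
    show "\<forall>r\<in>set (fold (refine (map (map (\<lambda>x. nat \<bar>x\<bar>)) ?X)) certificate7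
        (map (\<lambda>_. List.product [0..<9] [0..<9]) ?X)). \<forall>(a, b)\<in>set r. a = b"
      unfolding T R by (simp add: certificate7_def checker_defs)
  qed
  moreover have "length ?X = 7"
    by (simp add: quaternions7_def)
  ultimately show ?thesis
    by (simp only:)
qed

theorem proposition7p1:
  shows "(\<exists>(A :: nat \<Rightarrow> int mat) (L :: 3 mat).
            (\<forall>i<6. \<exists>\<gamma>. orthogonality_factor 3 (A i) \<gamma>) \<and>
            distinct_square_products 6 A \<and>
            L \<in> carrier_mat 6 6 \<and> invertible_mat L \<and>
            proper_euler_magic 729 1383621370577137212748452225 (reindexed_tensor 6 L A)) \<and>
         (\<exists>(B :: nat \<Rightarrow> int mat) (L' :: 3 mat).
            (\<forall>i<7. \<exists>\<gamma>. orthogonality_factor 3 (B i) \<gamma>) \<and>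
            distinct_square_products 7 B \<and>
            L' \<in> carrier_mat 7 7 \<and> invertible_mat L' \<and>
            proper_euler_magic 2187 1374777097726234503832371133749225 (reindexed_tensor 7 L' B))"
proof -
  have "\<exists>(A :: nat \<Rightarrow> int mat) (L :: 3 mat).
      (\<forall>i<6. \<exists>\<gamma>. orthogonality_factor 3 (A i) \<gamma>) \<and> distinct_square_products 6 A \<and>
      L \<in> carrier_mat 6 6 \<and> invertible_mat L \<and>
      proper_euler_magic (3 ^ 6) (\<Prod>i<6. (quaternion_norm (quaternions6 ! i))\<^sup>2) (reindexed_tensor 6 L A)"
    by (rule proper_euler_magic_rotations[OF distinct_square_products_quaternions6 _ _ _ invertible_L6
          diagonally_balanced_L6])
      (simp_all add: quaternions6_def L6_def)
  moreover have "(\<Prod>i<6. (quaternion_norm (quaternions6 ! i))\<^sup>2) = 1383621370577137212748452225"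
    by (simp add: quaternions6_def lessThan_nat_numeral)
  moreover have "\<exists>(A :: nat \<Rightarrow> int mat) (L :: 3 mat).
      (\<forall>i<7. \<exists>\<gamma>. orthogonality_factor 3 (A i) \<gamma>) \<and> distinct_square_products 7 A \<and>
      L \<in> carrier_mat 7 7 \<and> invertible_mat L \<and>
      proper_euler_magic (3 ^ 7) (\<Prod>i<7. (quaternion_norm (quaternions7 ! i))\<^sup>2) (reindexed_tensor 7 L A)"
    by (rule proper_euler_magic_rotations[OF distinct_square_products_quaternions7 _ _ _ invertible_L7
          diagonally_balanced_L7])
      (simp_all add: quaternions7_def L7_def)
  moreover have "(\<Prod>i<7. (quaternion_norm (quaternions7 ! i))\<^sup>2) = 1374777097726234503832371133749225"
    by (simp add: quaternions7_def lessThan_nat_numeral)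
  moreover have "(3 :: nat) ^ 6 = 729" "(3 :: nat) ^ 7 = 2187"
    by simp_all
  ultimately show ?thesis
    by (simp only:)
qed

end
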